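(* Let $M$ be an orientable $(2,3)$ sub-Riemannian manifold with horizontal bundle $\mathcal{H}$, $U\subseteq M$ open and $p\in U$. Let $\{X_1,X_2\}$ and $\{X_1',X_2'\}$ be ordered orthonormal frames of $\mathcal{H}$ on $U$ related by $X_1'=\cos\theta\,X_1+\sin\theta\,X_2$ and $X_2'=-\sin\theta\,X_1+\cos\theta\,X_2$ with $\theta:U\to\mathbb{R}$ smooth, and put $X_3=[X_1,X_2]$, $X_3'=[X_1',X_2']$. Suppose both $\{X_1,X_2\}$ and $\{X_1',X_2'\}$ are Carnot frames for $\mathcal{H}$ at $p$. Then all first and second order horizontal derivatives of $\theta$ at $p$ equal $0$, i.e. $(X_i\theta)(p)=0$ and $(X_iX_j\theta)(p)=0$ for all $i,j\in\{1,2\}$, and $(X_3)_p=(X_3')_p$.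
   Context: A sub-Riemannian structure on a smooth manifold $M$ is a pair $(\mathcal{H},\langle\cdot,\cdot\rangle)$ with $\mathcal{H}$ a smooth sub-bundle of $TM$ and $\langle\cdot,\cdot\rangle$ a smooth fiber inner product on $\mathcal{H}$. A $(2,3)$ sub-Riemannian manifold is a smooth $3$-manifold with such a structure in which $\mathcal{H}$ has rank $2$ and, at every point, $\mathcal{H}$ together with brackets of local sections of $\mathcal{H}$ spans the tangent space. A Carnot frame for $\mathcal{H}$ at $p\in U$ is an ordered orthonormal frame $\{X_1,X_2\}$ of $\mathcal{H}$ on $U$ such that, with $X_3=[X_1,X_2]$, $[X_1,X_3]_p=0$ and $[X_2,X_3]_p=0$. *)

theory Defs
  imports "HOL-Analysis.Analysis" "HOL-Library.Function_Algebras"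
begin

text \<open>
  Tangent vectors are represented as real-valued functionals on real-valued functions, so
  function spaces are made into real vector spaces with the pointwise operations.
\<close>

instantiation "fun" :: (type, scaleR) scaleR
begin

definition scaleR_fun :: "real \<Rightarrow> ('a \<Rightarrow> 'b) \<Rightarrow> 'a \<Rightarrow> 'b" where
  "scaleR_fun r f = (\<lambda>x. r *\<^sub>R f x)"

instance ..

end

instance "fun" :: (type, real_vector) real_vector
  by standard (simp_all add: scaleR_fun_def fun_eq_iff scaleR_add_right scaleR_add_left)

text \<open>
  Both notions are meant for open sets \<open>S\<close>: the derivative is the one at \<open>x\<close>, not within \<open>S\<close>.
\<close>

fun Ck_on :: "nat \<Rightarrow> 'a::euclidean_space set \<Rightarrow> ('a \<Rightarrow> 'b::real_normed_vector) \<Rightarrow> bool" where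
  "Ck_on 0 S f \<longleftrightarrow> continuous_on S f"
| "Ck_on (Suc k) S f \<longleftrightarrow>
     (\<forall>x\<in>S. f differentiable (at x)) \<and>
     (\<forall>v. Ck_on k S (\<lambda>x. frechet_derivative f (at x) v))"

definition smooth_on :: "'a::euclidean_space set \<Rightarrow> ('a \<Rightarrow> 'b::real_normed_vector) \<Rightarrow> bool" where
  "smooth_on S f \<longleftrightarrow> (\<forall>k. Ck_on k S f)"

text \<open>
  The manifold is the whole type \<open>'a\<close>; the Hausdorff and second countability axioms are expressed
  by the sort of \<open>'a\<close>, and the dimension is \<open>CARD('n)\<close>. The smooth structure is given by any smooth
  atlas, not necessarily a maximal one.
\<close>

type_synonym ('a, 'n) chart = "'a set \<times> ('a \<Rightarrow> real ^ 'n)"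

definition chart_inv :: "('a, 'n) chart \<Rightarrow> real ^ 'n \<Rightarrow> 'a" where
  "chart_inv c = inv_into (fst c) (snd c)"

definition is_chart :: "('a::topological_space, 'n::finite) chart \<Rightarrow> bool" where
  "is_chart c \<longleftrightarrow> open (fst c) \<and> open (snd c ` fst c) \<and>
     homeomorphism (fst c) (snd c ` fst c) (snd c) (chart_inv c)"

definition smooth_atlas :: "('a::topological_space, 'n::finite) chart set \<Rightarrow> bool" where
  "smooth_atlas \<A> \<longleftrightarrow>
     (\<forall>c\<in>\<A>. is_chart c) \<and> (\<Union>c\<in>\<A>. fst c) = UNIV \<and>
     (\<forall>c\<in>\<A>. \<forall>d\<in>\<A>. smooth_on (snd c ` (fst c \<inter> fst d)) (snd d \<circ> chart_inv c))"

definition orientable :: "('a::topological_space, 'n::finite) chart set \<Rightarrow> bool" where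
  "orientable \<A> \<longleftrightarrow>
     (\<exists>\<B>. smooth_atlas \<B> \<and> smooth_atlas (\<A> \<union> \<B>) \<and>
        (\<forall>c\<in>\<B>. \<forall>d\<in>\<B>. \<forall>x \<in> snd c ` (fst c \<inter> fst d).
           det (matrix (frechet_derivative (snd d \<circ> chart_inv c) (at x))) > 0))"

definition smooth_fun ::
  "('a::topological_space, 'n::finite) chart set \<Rightarrow> 'a set \<Rightarrow> ('a \<Rightarrow> real) \<Rightarrow> bool" where
  "smooth_fun \<A> W f \<longleftrightarrow> (\<forall>c\<in>\<A>. smooth_on (snd c ` (fst c \<inter> W)) (f \<circ> chart_inv c))"

definition smooth_near ::
  "('a::topological_space, 'n::finite) chart set \<Rightarrow> 'a \<Rightarrow> ('a \<Rightarrow> real) \<Rightarrow> bool" where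
  "smooth_near \<A> p f \<longleftrightarrow> (\<exists>W. open W \<and> p \<in> W \<and> smooth_fun \<A> W f)"

type_synonym 'a functional = "('a \<Rightarrow> real) \<Rightarrow> real"

text \<open>
  The tangent space at \<open>p\<close> consists of the derivations of germs at \<open>p\<close> of smooth functions. The first
  condition fixes the otherwise arbitrary values on functions that are not smooth near \<open>p\<close>, so that
  a derivation determines the functional uniquely.
\<close>

definition tangent_space ::
  "('a::topological_space, 'n::finite) chart set \<Rightarrow> 'a \<Rightarrow> 'a functional set" where
  "tangent_space \<A> p = {v.
     (\<forall>f. \<not> smooth_near \<A> p f \<longrightarrow> v f = 0) \<and>
     (\<forall>f g. smooth_near \<A> p f \<and> smooth_near \<A> p g \<longrightarrow>
        ((\<forall>\<^sub>F x in nhds p. f x = g x) \<longrightarrow> v f = v g) \<and>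
        (\<forall>a b. v (\<lambda>x. a * f x + b * g x) = a * v f + b * v g) \<and>
        v (\<lambda>x. f x * g x) = f p * v g + g p * v f)}"

text \<open>A vector field on \<open>W\<close> may take arbitrary values outside \<open>W\<close>.\<close>

type_synonym 'a field = "'a \<Rightarrow> 'a functional"

definition smooth_vector_field ::
  "('a::topological_space, 'n::finite) chart set \<Rightarrow> 'a set \<Rightarrow> 'a field \<Rightarrow> bool" where
  "smooth_vector_field \<A> W X \<longleftrightarrow>
     (\<forall>x\<in>W. X x \<in> tangent_space \<A> x) \<and>
     (\<forall>V f. open V \<and> V \<subseteq> W \<and> smooth_fun \<A> V f \<longrightarrow> smooth_fun \<A> V (\<lambda>x. X x f))"

text \<open>
  The case distinction makes the bracket satisfy the normalisation required of the elements of
  \<^const>\<open>tangent_space\<close>.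
\<close>

definition lie_bracket ::
  "('a::topological_space, 'n::finite) chart set \<Rightarrow> 'a field \<Rightarrow> 'a field \<Rightarrow> 'a field" where
  "lie_bracket \<A> X Y = (\<lambda>x f.
     if smooth_near \<A> x f then X x (\<lambda>y. Y y f) - Y x (\<lambda>y. X y f) else 0)"

definition smooth_subbundle ::
  "('a::topological_space, 'n::finite) chart set \<Rightarrow> nat \<Rightarrow> ('a \<Rightarrow> 'a functional set) \<Rightarrow> bool" where
  "smooth_subbundle \<A> k H \<longleftrightarrow>
     (\<forall>x. subspace (H x) \<and> H x \<subseteq> tangent_space \<A> x) \<and>
     (\<forall>p. \<exists>W E. open W \<and> p \<in> W \<and> (\<forall>i<k. smooth_vector_field \<A> W (E i)) \<and>
        (\<forall>x\<in>W. inj_on (\<lambda>i. E i x) {..<k} \<and> independent ((\<lambda>i. E i x) ` {..<k}) \<and>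
           H x = span ((\<lambda>i. E i x) ` {..<k})))"

definition smooth_section ::
  "('a::topological_space, 'n::finite) chart set \<Rightarrow> ('a \<Rightarrow> 'a functional set) \<Rightarrow>
   'a set \<Rightarrow> 'a field \<Rightarrow> bool" where
  "smooth_section \<A> H W X \<longleftrightarrow> smooth_vector_field \<A> W X \<and> (\<forall>x\<in>W. X x \<in> H x)"

definition smooth_fiber_inner ::
  "('a::topological_space, 'n::finite) chart set \<Rightarrow> ('a \<Rightarrow> 'a functional set) \<Rightarrow>
   ('a \<Rightarrow> 'a functional \<Rightarrow> 'a functional \<Rightarrow> real) \<Rightarrow> bool" where
  "smooth_fiber_inner \<A> H g \<longleftrightarrow>
     (\<forall>x. \<forall>u\<in>H x. \<forall>v\<in>H x. g x u v = g x v u) \<and>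
     (\<forall>x. \<forall>u\<in>H x. \<forall>v\<in>H x. \<forall>w\<in>H x. g x (u + v) w = g x u w + g x v w) \<and>
     (\<forall>x r. \<forall>u\<in>H x. \<forall>v\<in>H x. g x (r *\<^sub>R u) v = r * g x u v) \<and>
     (\<forall>x. \<forall>u\<in>H x. u \<noteq> 0 \<longrightarrow> g x u u > 0) \<and>
     (\<forall>W X Y. open W \<and> smooth_section \<A> H W X \<and> smooth_section \<A> H W Y \<longrightarrow>
        smooth_fun \<A> W (\<lambda>x. g x (X x) (Y x)))"

definition sub_riemannian_2_3 ::
  "('a::{t2_space, second_countable_topology}, 3) chart set \<Rightarrow> ('a \<Rightarrow> 'a functional set) \<Rightarrow>
   ('a \<Rightarrow> 'a functional \<Rightarrow> 'a functional \<Rightarrow> real) \<Rightarrow> bool" where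
  "sub_riemannian_2_3 \<A> H g \<longleftrightarrow>
     smooth_atlas \<A> \<and> smooth_subbundle \<A> 2 H \<and> smooth_fiber_inner \<A> H g \<and>
     (\<forall>x. span (H x \<union> {lie_bracket \<A> X Y x | X Y W. open W \<and> x \<in> W \<and>
                          smooth_section \<A> H W X \<and> smooth_section \<A> H W Y})
          = tangent_space \<A> x)"

definition orthonormal_frame ::
  "('a::topological_space, 'n::finite) chart set \<Rightarrow> ('a \<Rightarrow> 'a functional set) \<Rightarrow>
   ('a \<Rightarrow> 'a functional \<Rightarrow> 'a functional \<Rightarrow> real) \<Rightarrow> 'a set \<Rightarrow> 'a field \<Rightarrow> 'a field \<Rightarrow> bool" where
  "orthonormal_frame \<A> H g U X1 X2 \<longleftrightarrow>
     smooth_section \<A> H U X1 \<and> smooth_section \<A> H U X2 \<and>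
     (\<forall>x\<in>U. H x = span {X1 x, X2 x} \<and>
        g x (X1 x) (X1 x) = 1 \<and> g x (X2 x) (X2 x) = 1 \<and> g x (X1 x) (X2 x) = 0)"

definition carnot_frame ::
  "('a::topological_space, 'n::finite) chart set \<Rightarrow> ('a \<Rightarrow> 'a functional set) \<Rightarrow>
   ('a \<Rightarrow> 'a functional \<Rightarrow> 'a functional \<Rightarrow> real) \<Rightarrow> 'a set \<Rightarrow> 'a \<Rightarrow> 'a field \<Rightarrow> 'a field \<Rightarrow> bool" where
  "carnot_frame \<A> H g U p X1 X2 \<longleftrightarrow>
     open U \<and> p \<in> U \<and> orthonormal_frame \<A> H g U X1 X2 \<and>
     lie_bracket \<A> X1 (lie_bracket \<A> X1 X2) p = 0 \<and>
     lie_bracket \<A> X2 (lie_bracket \<A> X1 X2) p = 0"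

end

theory Submission
  imports Defs
begin

text \<open>
  Write \<open>\<theta>\<^sub>i = X\<^sub>i \<theta>\<close> and \<open>\<tau> = X\<^sub>3' \<theta>\<close>. The Leibniz rule gives
  \<open>X\<^sub>3' = X\<^sub>3 - \<theta>\<^sub>1 X\<^sub>1 - \<theta>\<^sub>2 X\<^sub>2\<close> on \<open>U\<close>. Since \<open>X\<^sub>1\<close>, \<open>X\<^sub>2\<close>, \<open>X\<^sub>3\<close> are linearly independent at \<open>p\<close>, the
  coefficients of \<open>[X\<^sub>1', X\<^sub>3']\<close> and \<open>[X\<^sub>2', X\<^sub>3']\<close> in them vanish at \<open>p\<close>. Those of \<open>X\<^sub>3\<close> give
  \<open>\<theta>\<^sub>1 = \<theta>\<^sub>2 = 0\<close>, hence \<open>X\<^sub>3 = X\<^sub>3'\<close>; the others give \<open>X\<^sub>i \<theta>\<^sub>i = 0\<close> and \<open>X\<^sub>2 \<theta>\<^sub>1 = \<tau> = - X\<^sub>1 \<theta>\<^sub>2\<close>. Then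
  \<open>\<tau> = X\<^sub>3 \<theta> = X\<^sub>1 \<theta>\<^sub>2 - X\<^sub>2 \<theta>\<^sub>1 = - 2 \<tau>\<close>, so \<open>\<tau> = 0\<close>.

  Independence holds because otherwise all brackets of sections would lie in the plane \<open>\<H>\<^sub>p\<close> at \<open>p\<close>,
  whereas a chart provides three independent derivations.
\<close>

section \<open>Calculus of \<open>Ck_on\<close> functions on open subsets of Euclidean space\<close>

lemma Ck_on_SucD:
  "Ck_on (Suc k) S f \<Longrightarrow> x \<in> S \<Longrightarrow> (f has_derivative frechet_derivative f (at x)) (at x)"
  by (simp add: frechet_derivative_works)

lemma Ck_on_Suc_imp: "Ck_on (Suc k) S f \<Longrightarrow> Ck_on k S f"
proof (induction k arbitrary: f)
  case 0
  then show ?case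
    by (auto intro!: continuous_at_imp_continuous_on differentiable_imp_continuous_within)
next
  case (Suc k)
  from Suc.prems have "Ck_on k S (\<lambda>x. frechet_derivative f (at x) v)" for v
    by (subst (asm) Ck_on.simps) (blast intro: Suc.IH)
  with Suc.prems show ?case by simp
qed

lemma Ck_on_subset: "Ck_on k S f \<Longrightarrow> T \<subseteq> S \<Longrightarrow> Ck_on k T f"
  by (induction k arbitrary: f) (auto intro: continuous_on_subset)

text \<open>The derivative at a point of an open set depends only on the values nearby, so it passes
  from \<open>f\<close> to \<open>g\<close>, and by induction so do the iterated
  derivatives.\<close>

lemma Ck_on_cong:
  assumes "open S" "\<And>x. x \<in> S \<Longrightarrow> f x = g x" "Ck_on k S f"
  shows "Ck_on k S g"
  using assms(2,3)
proof (induction k arbitrary: f g)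
  case 0
  then show ?case using continuous_on_cong[of S S f g] by simp
next
  case (Suc k)
  have D: "(g has_derivative frechet_derivative f (at x)) (at x)" if "x \<in> S" for x
    using Ck_on_SucD[OF Suc.prems(2) that] assms(1) that Suc.prems(1)
    by (rule has_derivative_transform_within_open)
  have "frechet_derivative f (at x) v = frechet_derivative g (at x) v" if "x \<in> S" for x v
    using frechet_derivative_at[OF D[OF that]] by simp
  then have "Ck_on k S (\<lambda>x. frechet_derivative g (at x) v)" for v
    using Suc.IH Suc.prems(2) by (metis (no_types, lifting) Ck_on.simps(2))
  with D show ?case by (auto simp: differentiable_def)
qed

text \<open>Any explicit derivative may stand in for the chosen \<open>frechet_derivative\<close>.
  The closure properties below feed the usual differentiation rules into this form.\<close>

lemma Ck_on_SucI:
  assumes "open S" "\<And>x. x \<in> S \<Longrightarrow> (f has_derivative f' x) (at x)"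
    and "\<And>v. Ck_on k S (\<lambda>x. f' x v)"
  shows "Ck_on (Suc k) S f"
proof -
  have "Ck_on k S (\<lambda>x. frechet_derivative f (at x) v)" for v
    by (rule Ck_on_cong[OF assms(1) _ assms(3)[of v]])
      (use frechet_derivative_at[OF assms(2)] in force)
  with assms(2) show ?thesis by (auto simp: differentiable_def)
qed

lemma Ck_on_const: "open S \<Longrightarrow> Ck_on k S (\<lambda>x. c)"
proof (induction k arbitrary: c)
  case (Suc k)
  then show ?case by (intro Ck_on_SucI[where f' = "\<lambda>x v. 0"]) auto
qed simp

lemma Ck_on_add:
  "open S \<Longrightarrow> Ck_on k S f \<Longrightarrow> Ck_on k S g \<Longrightarrow> Ck_on k S (\<lambda>x. f x + g x)"
proof (induction k arbitrary: f g)
  case 0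
  then show ?case by (simp add: continuous_on_add)
next
  case (Suc k)
  show ?case
    by (rule Ck_on_SucI[OF Suc.prems(1)
          has_derivative_add[OF Ck_on_SucD[OF Suc.prems(2)] Ck_on_SucD[OF Suc.prems(3)]]])
      (use Suc in auto)
qed

lemma Ck_on_mult:
  fixes f g :: "'a::euclidean_space \<Rightarrow> real"
  shows "open S \<Longrightarrow> Ck_on k S f \<Longrightarrow> Ck_on k S g \<Longrightarrow> Ck_on k S (\<lambda>x. f x * g x)"
proof (induction k arbitrary: f g)
  case 0
  then show ?case by (simp add: continuous_on_mult)
next
  case (Suc k)
  \<comment> \<open>The product rule also contains \<open>f\<close> and \<open>g\<close>
    undifferentiated, so both are needed at the lower order \<open>k\<close>.\<close>
  note lower = Suc.prems(2,3)[THEN Ck_on_Suc_imp]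
  show ?case
    by (rule Ck_on_SucI[OF Suc.prems(1)
          has_derivative_mult[OF Ck_on_SucD[OF Suc.prems(2)] Ck_on_SucD[OF Suc.prems(3)]]])
      (use Suc lower in \<open>auto intro!: Ck_on_add\<close>)
qed

lemma Ck_on_bounded_linear:
  assumes "bounded_linear L" "open S"
  shows "Ck_on k S f \<Longrightarrow> Ck_on k S (\<lambda>x. L (f x))"
proof (induction k arbitrary: f)
  case 0
  then show ?case
    using bounded_linear.continuous_on[OF assms(1)] by auto
next
  case (Suc k)
  show ?case
    by (rule Ck_on_SucI[OF assms(2)
          bounded_linear.has_derivative[OF assms(1) Ck_on_SucD[OF Suc.prems]]])
      (use Suc in auto)
qed

text \<open>Taking the whole sequence of derivatives \<open>h n\<close> keeps the induction closed:
  the chain rule replaces \<open>h n\<close> by \<open>h (Suc n)\<close> times a derivative of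
  \<open>f\<close>, and \<open>n\<close> is generalised.\<close>

lemma Ck_on_compose_real:
  fixes h :: "nat \<Rightarrow> real \<Rightarrow> real"
  assumes "\<And>n t. (h n has_real_derivative h (Suc n) t) (at t)" "open S"
  shows "Ck_on k S f \<Longrightarrow> Ck_on k S (\<lambda>x. h n (f x))"
proof (induction k arbitrary: n)
  case 0
  have "continuous_on UNIV (h n)"
    using DERIV_isCont[OF assms(1)[of n]] by (simp add: continuous_on_eq_continuous_at)
  with 0 show ?case
    by (auto intro: continuous_on_compose2)
next
  case (Suc k)
  have "((\<lambda>x. h n (f x)) has_derivative (\<lambda>v. h (Suc n) (f x) * frechet_derivative f (at x) v)) (at x)"
    if "x \<in> S" for x
    using assms(1)[of n "f x"] unfolding has_field_derivative_def
    by (rule has_derivative_compose[OF Ck_on_SucD[OF Suc.prems that]])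
  moreover have "Ck_on k S (\<lambda>x. h (Suc n) (f x) * frechet_derivative f (at x) v)" for v
    using Suc.prems by (intro Ck_on_mult assms(2) Suc.IH Ck_on_Suc_imp[OF Suc.prems]) simp
  ultimately show ?case
    by (rule Ck_on_SucI[OF assms(2)])
qed

text \<open>
  The chain rule for sine and cosine under an abstract derivation is not part of the Leibniz rule. With
  \<open>sin t = t h(t)\<close> for a smooth \<open>h\<close> it becomes one at points where the argument vanishes, and the
  addition formulas reduce to that case. The functions \<open>h n\<close> below are the derivatives of \<open>h = h 0\<close>.
\<close>

lemma sin_eq_times_smooth:
  obtains h :: "nat \<Rightarrow> real \<Rightarrow> real"
  where "\<And>n t. (h n has_real_derivative h (Suc n) t) (at t)" "h 0 0 = 1"
    "\<And>t. sin t = t * h 0 t"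
proof -
  \<comment> \<open>\<open>c k\<close> is the coefficient of \<open>t ^ k\<close> in the power
    series of \<open>sin t / t\<close>. Since \<open>diffs\<close> differentiates a series termwise,
    \<open>h n\<close> is the n-th derivative of its sum.\<close>
  define c :: "nat \<Rightarrow> real" where "c = (\<lambda>k. sin_coeff (Suc k))"
  define h where "h = (\<lambda>n t. \<Sum>k. (diffs ^^ n) c k * t ^ k)"
  have sin_sum: "summable (\<lambda>n. sin_coeff n * t ^ n)" for t :: real
    using sin_converges[of t] by (simp add: sums_iff)
  have c_sum: "summable (\<lambda>k. c k * t ^ k)" for t
  proof (cases "t = 0")
    case False
    have "summable (\<lambda>k. inverse t * (sin_coeff (Suc k) * t ^ Suc k))"
      using sin_sum[of t] by (intro summable_mult summable_Suc_iff[THEN iffD2])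
    with False show ?thesis by (simp add: c_def mult_ac)
  qed simp
  have summ: "summable (\<lambda>k. (diffs ^^ n) c k * t ^ k)" for n t
    by (induction n arbitrary: t) (auto intro!: c_sum termdiff_converges_all)
  show ?thesis
  proof
    show "(h n has_real_derivative h (Suc n) t) (at t)" for n t
      unfolding h_def using termdiffs_strong_converges_everywhere[OF summ, of n] by simp
    show "h 0 0 = 1" by (simp add: h_def c_def sin_coeff_def)
    show "sin t = t * h 0 t" for t
    proof -
      have "sin t = (\<Sum>k. sin_coeff k * t ^ k)"
        using sin_converges[of t] by (simp add: sums_iff)
      also have "\<dots> = (\<Sum>k. sin_coeff (Suc k) * t ^ Suc k)"
        using suminf_split_head[OF sin_sum[of t]] by simp
      also have "\<dots> = t * (\<Sum>k. c k * t ^ k)"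
        by (subst suminf_mult[OF c_sum, symmetric]) (simp add: c_def mult_ac)
      finally show ?thesis by (simp add: h_def)
    qed
  qed
qed

text \<open>Each differentiation shifts the argument by a quarter period. Index 0 is sine and index
  1 is cosine, so one family yields the smoothness of both.\<close>

lemma sin_derivatives: "((\<lambda>t. sin (t + real n * pi / 2)) has_real_derivative
    sin (t + real (Suc n) * pi / 2)) (at t)"
proof -
  have "t + real (Suc n) * pi / 2 = (t + real n * pi / 2) + pi / 2"
    by (simp add: field_simps)
  then have "sin (t + real (Suc n) * pi / 2) = cos (t + real n * pi / 2)"
    by (simp only: sin_add) simp
  then show ?thesis by (auto intro!: derivative_eq_intros)
qed

section \<open>Charts and smooth functions on a manifold\<close>

lemma is_chart_open_image:
  assumes "is_chart c" "open W"
  shows "open (snd c ` (fst c \<inter> W))"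
proof -
  have "openin (top_of_set (snd c ` fst c)) (snd c ` (fst c \<inter> W))"
    using assms unfolding is_chart_def
    by (auto intro!: homeomorphism_imp_open_map openin_open_Int)
  then show ?thesis using assms unfolding is_chart_def
    using openin_open_eq by blast
qed

lemma chart_inv_left: "is_chart c \<Longrightarrow> x \<in> fst c \<Longrightarrow> chart_inv c (snd c x) = x"
  by (simp add: is_chart_def homeomorphism_def)

lemma smooth_fun_subset: "smooth_fun \<A> W f \<Longrightarrow> V \<subseteq> W \<Longrightarrow> smooth_fun \<A> V f"
  unfolding smooth_fun_def smooth_on_def
  by (meson Ck_on_subset Int_mono image_mono subset_refl)

lemma smooth_nearI: "smooth_fun \<A> W f \<Longrightarrow> open W \<Longrightarrow> p \<in> W \<Longrightarrow> smooth_near \<A> p f"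
  unfolding smooth_near_def by blast

locale smooth_manifold =
  fixes \<A> :: "('a::topological_space, 'n::finite) chart set"
  assumes atlas: "smooth_atlas \<A>"
begin

lemma chart: "c \<in> \<A> \<Longrightarrow> is_chart c"
  using atlas unfolding smooth_atlas_def by blast

lemma smooth_fun_cong:
  assumes "open W" "\<And>x. x \<in> W \<Longrightarrow> f x = g x" "smooth_fun \<A> W f"
  shows "smooth_fun \<A> W g"
  unfolding smooth_fun_def smooth_on_def
proof (intro ballI allI)
  fix c k assume "c \<in> \<A>"
  with assms show "Ck_on k (snd c ` (fst c \<inter> W)) (g \<circ> chart_inv c)"
    by (intro Ck_on_cong[of _ "f \<circ> chart_inv c" "g \<circ> chart_inv c"] is_chart_open_image)
      (auto simp: chart chart_inv_left smooth_fun_def smooth_on_def)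
qed

lemma smooth_fun_const: "open W \<Longrightarrow> smooth_fun \<A> W (\<lambda>x. a)"
  by (simp add: smooth_fun_def smooth_on_def o_def Ck_on_const chart is_chart_open_image)

lemma smooth_fun_add:
  "open W \<Longrightarrow> smooth_fun \<A> W f \<Longrightarrow> smooth_fun \<A> W g \<Longrightarrow> smooth_fun \<A> W (\<lambda>x. f x + g x)"
  by (simp add: smooth_fun_def smooth_on_def o_def Ck_on_add chart is_chart_open_image)

lemma smooth_fun_mult:
  "open W \<Longrightarrow> smooth_fun \<A> W f \<Longrightarrow> smooth_fun \<A> W g \<Longrightarrow> smooth_fun \<A> W (\<lambda>x. f x * g x)"
  by (simp add: smooth_fun_def smooth_on_def o_def Ck_on_mult chart is_chart_open_image)

lemma smooth_fun_minus:
  "open W \<Longrightarrow> smooth_fun \<A> W f \<Longrightarrow> smooth_fun \<A> W (\<lambda>x. - f x)"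
  using smooth_fun_mult[OF _ smooth_fun_const[of W "-1"], of f] by simp

lemma smooth_fun_diff:
  "open W \<Longrightarrow> smooth_fun \<A> W f \<Longrightarrow> smooth_fun \<A> W g \<Longrightarrow> smooth_fun \<A> W (\<lambda>x. f x - g x)"
  using smooth_fun_add[OF _ _ smooth_fun_minus[of W g], of f] by simp

lemma smooth_fun_compose_real:
  assumes "\<And>n t. (h n has_real_derivative h (Suc n) t) (at t)" "open W" "smooth_fun \<A> W f"
  shows "smooth_fun \<A> W (\<lambda>x. h n (f x))"
  unfolding smooth_fun_def smooth_on_def
proof (intro ballI allI)
  fix c k assume c: "c \<in> \<A>"
  then have "Ck_on k (snd c ` (fst c \<inter> W)) (f \<circ> chart_inv c)"
    using assms(3) by (simp add: smooth_fun_def smooth_on_def)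
  from Ck_on_compose_real[of h, OF assms(1) is_chart_open_image[OF chart[OF c] assms(2)] this]
  show "Ck_on k (snd c ` (fst c \<inter> W)) ((\<lambda>x. h n (f x)) \<circ> chart_inv c)"
    by (simp add: o_def)
qed

lemma smooth_fun_sin: "open W \<Longrightarrow> smooth_fun \<A> W f \<Longrightarrow> smooth_fun \<A> W (\<lambda>x. sin (f x))"
  using smooth_fun_compose_real[of "\<lambda>n t. sin (t + real n * pi / 2)" W f 0] sin_derivatives
  by simp

lemma smooth_fun_cos: "open W \<Longrightarrow> smooth_fun \<A> W f \<Longrightarrow> smooth_fun \<A> W (\<lambda>x. cos (f x))"
  using smooth_fun_compose_real[of "\<lambda>n t. sin (t + real n * pi / 2)" W f 1] sin_derivatives
  by (simp add: sin_add)

lemmas smooth_fun_intros = smooth_fun_const smooth_fun_add smooth_fun_mult smooth_fun_minus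
  smooth_fun_diff smooth_fun_sin smooth_fun_cos

section \<open>Tangent vectors as derivations\<close>

lemma smooth_near_common:
  assumes "smooth_near \<A> p f" "smooth_near \<A> p g" "open W" "p \<in> W"
  obtains V where "open V" "p \<in> V" "V \<subseteq> W" "smooth_fun \<A> V f" "smooth_fun \<A> V g"
proof -
  obtain V1 V2 where "open V1" "p \<in> V1" "smooth_fun \<A> V1 f"
    "open V2" "p \<in> V2" "smooth_fun \<A> V2 g"
    using assms(1,2) unfolding smooth_near_def by blast
  with assms(3,4) show thesis
    by (intro that[of "V1 \<inter> V2 \<inter> W"]) (auto intro: smooth_fun_subset)
qed

text \<open>Locality of derivations. It serves to rewrite the inner function of an iterated
  derivative, where an identity is known only near the point.\<close>

lemma tangent_cong:
  assumes "v \<in> tangent_space \<A> p" "open W" "p \<in> W" "smooth_fun \<A> W f"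
    and "\<And>x. x \<in> W \<Longrightarrow> f x = g x"
  shows "v f = v g"
proof -
  have "smooth_fun \<A> W g"
    using assms(2,5,4) by (rule smooth_fun_cong)
  moreover have "\<forall>\<^sub>F x in nhds p. f x = g x"
    using assms unfolding eventually_nhds by blast
  ultimately show ?thesis
    using assms(1) smooth_nearI[of \<A> W _ p] assms(2-4) unfolding tangent_space_def by blast
qed

lemma tangent_lincomb:
  assumes "v \<in> tangent_space \<A> p" "open W" "p \<in> W" "smooth_fun \<A> W f" "smooth_fun \<A> W g"
  shows "v (\<lambda>x. a * f x + b * g x) = a * v f + b * v g"
  using assms smooth_nearI[of \<A> W _ p] unfolding tangent_space_def by blast

lemma tangent_mult:
  assumes "v \<in> tangent_space \<A> p" "open W" "p \<in> W" "smooth_fun \<A> W f" "smooth_fun \<A> W g"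
  shows "v (\<lambda>x. f x * g x) = f p * v g + g p * v f"
  using assms smooth_nearI[of \<A> W _ p] unfolding tangent_space_def by blast

text \<open>The Leibniz rule for the product \<open>1 * 1\<close> makes the derivative of 1 equal to
  its own double; linearity then covers every constant.\<close>

lemma tangent_const:
  assumes "v \<in> tangent_space \<A> p"
  shows "v (\<lambda>x. a) = 0"
proof -
  have "v (\<lambda>x. 1) = 0"
    using tangent_mult[OF assms open_UNIV UNIV_I smooth_fun_const[of UNIV 1] smooth_fun_const[of UNIV 1]]
    by simp
  then show ?thesis
    using tangent_lincomb[OF assms open_UNIV UNIV_I smooth_fun_const[of UNIV 1] smooth_fun_const[of UNIV 1],
        of a 0] by simp
qed

lemma tangent_add:
  assumes "v \<in> tangent_space \<A> p" "open W" "p \<in> W" "smooth_fun \<A> W f" "smooth_fun \<A> W g"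
  shows "v (\<lambda>x. f x + g x) = v f + v g"
  using tangent_lincomb[OF assms, of 1 1] by simp

lemma tangent_minus:
  assumes "v \<in> tangent_space \<A> p" "open W" "p \<in> W" "smooth_fun \<A> W f"
  shows "v (\<lambda>x. - f x) = - v f"
  using tangent_lincomb[OF assms assms(4), of "-1" 0] by simp

lemma tangent_diff:
  assumes "v \<in> tangent_space \<A> p" "open W" "p \<in> W" "smooth_fun \<A> W f" "smooth_fun \<A> W g"
  shows "v (\<lambda>x. f x - g x) = v f - v g"
  using tangent_lincomb[OF assms, of 1 "-1"] by simp

text \<open>In the Leibniz rule for \<open>f x * h 0 (f x)\<close> one term has the factor
  \<open>f p = 0\<close> and the other the factor \<open>h 0 0 = 1\<close>.\<close>

lemma tangent_sin_zero:
  assumes v: "v \<in> tangent_space \<A> p" "open W" "p \<in> W" and "smooth_fun \<A> W f" "f p = 0"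
  shows "v (\<lambda>x. sin (f x)) = v f"
proof -
  obtain h :: "nat \<Rightarrow> real \<Rightarrow> real"
    where h: "\<And>n t. (h n has_real_derivative h (Suc n) t) (at t)" "h 0 0 = 1"
      "\<And>t. sin t = t * h 0 t"
    using sin_eq_times_smooth by metis
  have "smooth_fun \<A> W (\<lambda>x. h 0 (f x))"
    by (rule smooth_fun_compose_real[of h, OF h(1) assms(2,4)])
  with tangent_mult[OF v assms(4)] assms(5) h(2) show ?thesis
    by (simp add: h(3))
qed

text \<open>The half-angle formula writes the cosine as 1 minus twice a square whose root
  \<open>s\<close> vanishes at \<open>p\<close>, so the Leibniz rule kills it.\<close>

lemma tangent_cos_zero:
  assumes v: "v \<in> tangent_space \<A> p" "open W" "p \<in> W" and "smooth_fun \<A> W f" "f p = 0"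
  shows "v (\<lambda>x. cos (f x)) = 0"
proof -
  define s where "s x = sin (1 / 2 * f x)" for x
  have s: "smooth_fun \<A> W s"
    unfolding s_def[abs_def] using assms by (intro smooth_fun_intros)
  have "cos (f x) = 1 * 1 + (- 2) * (s x * s x)" for x
    using cos_double_sin[of "1 / 2 * f x"] by (simp add: s_def power2_eq_square)
  then have "v (\<lambda>x. cos (f x)) = v (\<lambda>x. 1 * 1 + (- 2) * (s x * s x))"
    by simp
  also have "\<dots> = 1 * v (\<lambda>x. 1) + (- 2) * v (\<lambda>x. s x * s x)"
    using assms s by (intro tangent_lincomb[of _ p W] smooth_fun_intros)
  also have "\<dots> = 0"
    using tangent_mult[OF v s s] tangent_const[OF v(1)] assms(5) by (simp add: s_def)
  finally show ?thesis .
qed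

lemma
  assumes v: "v \<in> tangent_space \<A> p" "open W" "p \<in> W" and f: "smooth_fun \<A> W f"
  shows tangent_sin: "v (\<lambda>x. sin (f x)) = cos (f p) * v f"
    and tangent_cos: "v (\<lambda>x. cos (f x)) = - sin (f p) * v f"
proof -
  \<comment> \<open>\<open>u\<close> is \<open>f\<close> shifted by a constant so as to vanish at
    \<open>p\<close>; this leaves its derivative unchanged and makes the two preceding lemmas
    applicable.\<close>
  define u where "u x = f x - f p" for x
  have u: "smooth_fun \<A> W u" "u p = 0"
    unfolding u_def[abs_def] using assms by (auto intro: smooth_fun_intros)
  note su = smooth_fun_sin[OF v(2) u(1)] and cu = smooth_fun_cos[OF v(2) u(1)]
  have vu: "v u = v f"
    unfolding u_def[abs_def]
    using tangent_diff[OF v f smooth_fun_const[OF v(2)]] tangent_const[OF v(1)] by simp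
  have "sin (f x) = cos (f p) * sin (u x) + sin (f p) * cos (u x)" for x
    using sin_add[of "u x" "f p"] by (simp add: u_def)
  then have "v (\<lambda>x. sin (f x)) = v (\<lambda>x. cos (f p) * sin (u x) + sin (f p) * cos (u x))"
    by (intro arg_cong[where f = v] ext)
  also have "\<dots> = cos (f p) * v f"
    unfolding tangent_lincomb[OF v su cu] tangent_sin_zero[OF v u] tangent_cos_zero[OF v u] vu
    by simp
  finally show "v (\<lambda>x. sin (f x)) = cos (f p) * v f" .
  have "cos (f x) = cos (f p) * cos (u x) + - sin (f p) * sin (u x)" for x
    using cos_add[of "u x" "f p"] by (simp add: u_def)
  then have "v (\<lambda>x. cos (f x)) = v (\<lambda>x. cos (f p) * cos (u x) + - sin (f p) * sin (u x))"
    by (intro arg_cong[where f = v] ext)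
  also have "\<dots> = - sin (f p) * v f"
    unfolding tangent_lincomb[OF v cu su] tangent_sin_zero[OF v u] tangent_cos_zero[OF v u] vu
    by simp
  finally show "v (\<lambda>x. cos (f x)) = - sin (f p) * v f" .
qed

section \<open>Vector fields and the Lie bracket\<close>

lemma vector_field_tangent:
  "smooth_vector_field \<A> W X \<Longrightarrow> x \<in> W \<Longrightarrow> X x \<in> tangent_space \<A> x"
  unfolding smooth_vector_field_def by blast

lemma vector_field_smooth:
  "smooth_vector_field \<A> W X \<Longrightarrow> open V \<Longrightarrow> V \<subseteq> W \<Longrightarrow> smooth_fun \<A> V f \<Longrightarrow>
    smooth_fun \<A> V (\<lambda>x. X x f)"
  unfolding smooth_vector_field_def by blast

lemma vector_field_subset:
  "smooth_vector_field \<A> W X \<Longrightarrow> V \<subseteq> W \<Longrightarrow> smooth_vector_field \<A> V X"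
  unfolding smooth_vector_field_def by (meson order_trans subsetD)

lemma lie_bracket_eq:
  "smooth_fun \<A> V f \<Longrightarrow> open V \<Longrightarrow> x \<in> V \<Longrightarrow>
    lie_bracket \<A> X Y x f = X x (\<lambda>y. Y y f) - Y x (\<lambda>y. X y f)"
  by (auto simp: lie_bracket_def intro: smooth_nearI)

text \<open>Each of the two compositions violates the Leibniz rule by
  \<open>X p f * Y p g + X p g * Y p f\<close>. This is symmetric in the fields and cancels in the
  difference.\<close>

lemma lie_bracket_vector_field:
  assumes "open W" and X: "smooth_vector_field \<A> W X" and Y: "smooth_vector_field \<A> W Y"
  shows "smooth_vector_field \<A> W (lie_bracket \<A> X Y)"
proof -
  have "lie_bracket \<A> X Y p \<in> tangent_space \<A> p" if p: "p \<in> W" for p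
    unfolding tangent_space_def
  proof (intro CollectI conjI allI impI; (elim conjE)?)
    show "lie_bracket \<A> X Y p f = 0" if "\<not> smooth_near \<A> p f" for f
      using that by (simp add: lie_bracket_def)
  next
    fix f g assume fg: "smooth_near \<A> p f" "smooth_near \<A> p g"
    obtain V where V: "open V" "p \<in> V" "V \<subseteq> W" "smooth_fun \<A> V f" "smooth_fun \<A> V g"
      using smooth_near_common[OF fg assms(1) p] by blast
    note tX = vector_field_tangent[OF X] and tY = vector_field_tangent[OF Y]
    note sX = vector_field_smooth[OF X V(1,3)] and sY = vector_field_smooth[OF Y V(1,3)]
    \<comment> \<open>The outer derivation differentiates the inner one as a function of
      \<open>y\<close>, so the derivation rules are required at all \<open>y\<close> near
      \<open>p\<close>.\<close>
    have tXV: "X y \<in> tangent_space \<A> y" and tYV: "Y y \<in> tangent_space \<A> y" if "y \<in> V" for y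
      using that V(3) by (auto intro: tX tY)
    note br = lie_bracket_eq[OF _ V(1,2)]
    show "lie_bracket \<A> X Y p f = lie_bracket \<A> X Y p g"
      if germ: "\<forall>\<^sub>F x in nhds p. f x = g x"
    proof -
      obtain V' where V': "open V'" "p \<in> V'" "\<And>x. x \<in> V' \<Longrightarrow> f x = g x"
        using germ unfolding eventually_nhds by blast
      have D: "open (V \<inter> V')" "p \<in> V \<inter> V'" "V \<inter> V' \<subseteq> W" "smooth_fun \<A> (V \<inter> V') f"
        using V V' by (auto intro: smooth_fun_subset)
      \<comment> \<open>Functions agreeing on an open set have equal germs at each of its points, so
        the inner derivatives agree on a neighbourhood of \<open>p\<close>.\<close>
      have "X x f = X x g" and "Y x f = Y x g" if "x \<in> V \<inter> V'" for x
        using that V'(3) by (auto intro: tangent_cong[OF _ D(1) that D(4)] tXV tYV)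
      then have "X p (\<lambda>y. Y y f) = X p (\<lambda>y. Y y g)" "Y p (\<lambda>y. X y f) = Y p (\<lambda>y. X y g)"
        by (simp_all only: tangent_cong[OF tX[OF p] D(1,2) vector_field_smooth[OF Y D(1,3,4)]]
            tangent_cong[OF tY[OF p] D(1,2) vector_field_smooth[OF X D(1,3,4)]])
      then show ?thesis by (simp add: br V)
    qed
    show "lie_bracket \<A> X Y p (\<lambda>x. a * f x + b * g x) =
        a * lie_bracket \<A> X Y p f + b * lie_bracket \<A> X Y p g" for a b
    proof -
      have s: "smooth_fun \<A> V (\<lambda>x. a * f x + b * g x)"
        by (intro smooth_fun_intros V)
      have "X p (\<lambda>y. Y y (\<lambda>x. a * f x + b * g x)) = X p (\<lambda>y. a * Y y f + b * Y y g)"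
        by (rule tangent_cong[OF tX[OF p] V(1,2) sY[OF s]])
          (rule tangent_lincomb[OF tYV V(1) _ V(4,5)])
      moreover have "Y p (\<lambda>y. X y (\<lambda>x. a * f x + b * g x)) = Y p (\<lambda>y. a * X y f + b * X y g)"
        by (rule tangent_cong[OF tY[OF p] V(1,2) sX[OF s]])
          (rule tangent_lincomb[OF tXV V(1) _ V(4,5)])
      ultimately show ?thesis
        by (simp add: br s V tangent_lincomb[OF tX[OF p] V(1,2) sY sY]
            tangent_lincomb[OF tY[OF p] V(1,2) sX sX] algebra_simps)
    qed
    show "lie_bracket \<A> X Y p (\<lambda>x. f x * g x) =
        f p * lie_bracket \<A> X Y p g + g p * lie_bracket \<A> X Y p f"
    proof -
      have s: "smooth_fun \<A> V (\<lambda>x. f x * g x)"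
        by (intro smooth_fun_intros V)
      have "X p (\<lambda>y. Y y (\<lambda>x. f x * g x)) = X p (\<lambda>y. f y * Y y g + g y * Y y f)"
        by (rule tangent_cong[OF tX[OF p] V(1,2) sY[OF s]])
          (simp only: tangent_mult[OF tYV V(1) _ V(4,5)])
      also have "\<dots> = X p (\<lambda>y. f y * Y y g) + X p (\<lambda>y. g y * Y y f)"
        using V by (intro tangent_add[OF tX[OF p] V(1,2)] smooth_fun_intros sY)
      also have "\<dots> = f p * X p (\<lambda>y. Y y g) + Y p g * X p f + (g p * X p (\<lambda>y. Y y f) + Y p f * X p g)"
        using V by (simp add: tangent_mult[OF tX[OF p] V(1,2)] sY)
      finally have 1: "X p (\<lambda>y. Y y (\<lambda>x. f x * g x)) = \<dots>" .
      have "Y p (\<lambda>y. X y (\<lambda>x. f x * g x)) = Y p (\<lambda>y. f y * X y g + g y * X y f)"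
        by (rule tangent_cong[OF tY[OF p] V(1,2) sX[OF s]])
          (simp only: tangent_mult[OF tXV V(1) _ V(4,5)])
      also have "\<dots> = Y p (\<lambda>y. f y * X y g) + Y p (\<lambda>y. g y * X y f)"
        using V by (intro tangent_add[OF tY[OF p] V(1,2)] smooth_fun_intros sX)
      also have "\<dots> = f p * Y p (\<lambda>y. X y g) + X p g * Y p f + (g p * Y p (\<lambda>y. X y f) + X p f * Y p g)"
        using V by (simp add: tangent_mult[OF tY[OF p] V(1,2)] sX)
      finally show ?thesis
        using 1 by (simp add: br s V algebra_simps)
    qed
  qed
  moreover have "smooth_fun \<A> V (\<lambda>x. lie_bracket \<A> X Y x f)"
    if V: "open V" "V \<subseteq> W" "smooth_fun \<A> V f" for V f
  proof (rule smooth_fun_cong[OF V(1)])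
    show "smooth_fun \<A> V (\<lambda>x. X x (\<lambda>y. Y y f) - Y x (\<lambda>y. X y f))"
      by (intro smooth_fun_intros V vector_field_smooth[OF X] vector_field_smooth[OF Y])
  qed (simp add: lie_bracket_eq[OF V(3,1)])
  ultimately show ?thesis by (simp add: smooth_vector_field_def)
qed

lemma lie_bracket_flip: "lie_bracket \<A> X Y p = - lie_bracket \<A> Y X p"
  by (auto simp: lie_bracket_def fun_eq_iff)

lemma lie_bracket_self: "lie_bracket \<A> X X p = 0"
  by (auto simp: lie_bracket_def fun_eq_iff)

text \<open>The last two terms arise when \<open>Z\<close> differentiates the coefficients. Linear
  combinations in the other slot are reached through \<open>lie_bracket_flip\<close>.\<close>

lemma lie_bracket_lincomb_left:
  assumes W: "open W" "p \<in> W"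
    and X: "smooth_vector_field \<A> W X" and Y: "smooth_vector_field \<A> W Y"
    and Z: "smooth_vector_field \<A> W Z"
    and a: "smooth_fun \<A> W a" and b: "smooth_fun \<A> W b"
    and S: "\<And>x. x \<in> W \<Longrightarrow> S x = a x *\<^sub>R X x + b x *\<^sub>R Y x"
  shows "lie_bracket \<A> S Z p = a p *\<^sub>R lie_bracket \<A> X Z p + b p *\<^sub>R lie_bracket \<A> Y Z p
    - Z p a *\<^sub>R X p - Z p b *\<^sub>R Y p"
proof
  fix f
  note t = vector_field_tangent[OF X W(2)] vector_field_tangent[OF Y W(2)]
    vector_field_tangent[OF Z W(2)]
  show "lie_bracket \<A> S Z p f = (a p *\<^sub>R lie_bracket \<A> X Z p + b p *\<^sub>R lie_bracket \<A> Y Z p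
    - Z p a *\<^sub>R X p - Z p b *\<^sub>R Y p) f"
  proof (cases "smooth_near \<A> p f")
    \<comment> \<open>On functions not smooth near \<open>p\<close> both sides are 0 by the
      normalisations in \<open>lie_bracket_def\<close> and \<open>tangent_space_def\<close>.\<close>
    case False
    then have "X p f = 0" "Y p f = 0"
      using t unfolding tangent_space_def by blast+
    with False show ?thesis by (simp add: lie_bracket_def scaleR_fun_def)
  next
    case True
    then obtain V where V: "open V" "p \<in> V" "V \<subseteq> W" "smooth_fun \<A> V f"
      using smooth_near_common[OF True True W] by metis
    have ab: "smooth_fun \<A> V a" "smooth_fun \<A> V b"
      using a b V(3) by (auto intro: smooth_fun_subset)
    note s = vector_field_smooth[OF X V(1,3,4)] vector_field_smooth[OF Y V(1,3,4)]
    have "Z p (\<lambda>y. S y f) = Z p (\<lambda>y. a y * X y f + b y * Y y f)"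
    proof (rule tangent_cong[OF t(3) V(1,2), symmetric])
      show "smooth_fun \<A> V (\<lambda>y. a y * X y f + b y * Y y f)"
        by (intro smooth_fun_intros V(1) ab s)
      show "a y * X y f + b y * Y y f = S y f" if "y \<in> V" for y
        using S[of y] that V(3) by (auto simp: scaleR_fun_def)
    qed
    also have "\<dots> = Z p (\<lambda>y. a y * X y f) + Z p (\<lambda>y. b y * Y y f)"
      by (intro tangent_add[OF t(3) V(1,2)] smooth_fun_intros s ab V(1))
    also have "\<dots> = a p * Z p (\<lambda>y. X y f) + X p f * Z p a + (b p * Z p (\<lambda>y. Y y f) + Y p f * Z p b)"
      by (simp add: tangent_mult[OF t(3) V(1,2)] ab s)
    finally show ?thesis
      by (simp add: lie_bracket_eq[OF V(4,1,2)] S W scaleR_fun_def algebra_simps)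
  qed
qed

section \<open>Chart coordinates and the dimension of the tangent space\<close>

lemma smooth_fun_coordinate:
  assumes "c \<in> \<A>"
  shows "smooth_fun \<A> (fst c) (\<lambda>q. snd c q $ i)"
  unfolding smooth_fun_def smooth_on_def
proof (intro ballI allI)
  fix d k assume d: "d \<in> \<A>"
  \<comment> \<open>This is a transition map, smooth by the atlas axioms; the coordinate is a linear
    function of it.\<close>
  have "Ck_on k (snd d ` (fst d \<inter> fst c)) (snd c \<circ> chart_inv d)"
    using atlas assms d unfolding smooth_atlas_def smooth_on_def by blast
  moreover have "open (snd d ` (fst d \<inter> fst c))"
    using chart[OF assms] chart[OF d] by (simp add: is_chart_def is_chart_open_image)
  ultimately show "Ck_on k (snd d ` (fst d \<inter> fst c)) ((\<lambda>q. snd c q $ i) \<circ> chart_inv d)"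
    using Ck_on_bounded_linear[OF bounded_linear_vec_nth, of _ k "snd c \<circ> chart_inv d" i]
    by (simp add: o_def)
qed

lemma smooth_fun_has_derivative:
  assumes "c \<in> \<A>" "p \<in> fst c" "p \<in> W" "smooth_fun \<A> W f"
  shows "(f \<circ> chart_inv c has_derivative frechet_derivative (f \<circ> chart_inv c) (at (snd c p)))
    (at (snd c p))"
proof (rule Ck_on_SucD)
  show "Ck_on (Suc 0) (snd c ` (fst c \<inter> W)) (f \<circ> chart_inv c)"
    using assms(1,4) unfolding smooth_fun_def smooth_on_def by blast
qed (use assms in blast)

text \<open>Directional derivatives in a chart supply the tangent vectors for the dimension count.
  The default value 0 matches the normalisation in \<open>tangent_space_def\<close>.\<close>

lemma chart_derivative_tangent:
  assumes c: "c \<in> \<A>" "p \<in> fst c"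
  shows "(\<lambda>f. if smooth_near \<A> p f then frechet_derivative (f \<circ> chart_inv c) (at (snd c p)) w else 0)
    \<in> tangent_space \<A> p" (is "?v \<in> _")
proof -
  have cp: "chart_inv c (snd c p) = p"
    using c chart chart_inv_left by blast
  \<comment> \<open>As derivatives are unique, each condition can be checked by exhibiting any
    derivative of the composite with the chart.\<close>
  have vI: "?v f = f' w"
    if "smooth_near \<A> p f" "(f \<circ> chart_inv c has_derivative f') (at (snd c p))" for f f'
    using that frechet_derivative_at by auto
  show ?thesis
    unfolding tangent_space_def
  proof (intro CollectI conjI allI impI; (elim conjE)?)
    show "?v f = 0" if "\<not> smooth_near \<A> p f" for f
      using that by simp
  next
    fix f g assume fg: "smooth_near \<A> p f" "smooth_near \<A> p g"
    obtain W where W: "open W" "p \<in> W" and "W \<subseteq> UNIV" and sf: "smooth_fun \<A> W f" and sg: "smooth_fun \<A> W g"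
      by (rule smooth_near_common[OF fg open_UNIV UNIV_I])
    note f = smooth_fun_has_derivative[OF c W(2) sf] and g = smooth_fun_has_derivative[OF c W(2) sg]
    note near = smooth_nearI[OF _ W]
    show "?v f = ?v g" if germ: "\<forall>\<^sub>F x in nhds p. f x = g x"
    proof -
      obtain V where V: "open V" "p \<in> V" "\<forall>x\<in>V. f x = g x"
        using germ unfolding eventually_nhds by blast
      have "(g \<circ> chart_inv c has_derivative frechet_derivative (f \<circ> chart_inv c) (at (snd c p)))
          (at (snd c p))"
      proof (rule has_derivative_transform_within_open[OF f])
        show "open (snd c ` (fst c \<inter> V))"
          using chart[OF c(1)] V(1) by (rule is_chart_open_image)
        show "snd c p \<in> snd c ` (fst c \<inter> V)"
          using c V by blast
        show "(f \<circ> chart_inv c) y = (g \<circ> chart_inv c) y" if "y \<in> snd c ` (fst c \<inter> V)" for y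
          using that V(3) chart_inv_left[OF chart[OF c(1)]] by auto
      qed
      then show ?thesis
        using vI[OF fg(1) f] vI[OF fg(2)] by simp
    qed
    show "?v (\<lambda>x. a * f x + b * g x) = a * ?v f + b * ?v g" for a b
    proof -
      have "smooth_near \<A> p (\<lambda>x. a * f x + b * g x)"
        by (intro near smooth_fun_intros W(1) sf sg)
      moreover have "((\<lambda>x. a * f x + b * g x) \<circ> chart_inv c has_derivative
          (\<lambda>w. a * frechet_derivative (f \<circ> chart_inv c) (at (snd c p)) w
             + b * frechet_derivative (g \<circ> chart_inv c) (at (snd c p)) w)) (at (snd c p))"
        using has_derivative_add[OF has_derivative_mult_right[OF f, of a] has_derivative_mult_right[OF g, of b]]
        by (simp add: o_def)
      ultimately show ?thesis
        using vI by (simp add: fg)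
    qed
    show "?v (\<lambda>x. f x * g x) = f p * ?v g + g p * ?v f"
    proof -
      have "smooth_near \<A> p (\<lambda>x. f x * g x)"
        by (intro near smooth_fun_intros W(1) sf sg)
      moreover have "((\<lambda>x. f x * g x) \<circ> chart_inv c has_derivative
          (\<lambda>w. f p * frechet_derivative (g \<circ> chart_inv c) (at (snd c p)) w
             + frechet_derivative (f \<circ> chart_inv c) (at (snd c p)) w * g p)) (at (snd c p))"
        using has_derivative_mult[OF f g] by (simp add: o_def cp)
      ultimately show ?thesis
        using vI by (simp add: fg)
    qed
  qed
qed

text \<open>Evaluation on the coordinates of a chart maps the tangent space onto
  \<open>real ^ 'n\<close>, because the derivative along \<open>w\<close> has coordinates
  \<open>w\<close>. Hence the image of \<open>B\<close> spans \<open>real ^ 'n\<close>.\<close>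

lemma tangent_space_card_le:
  assumes "tangent_space \<A> p \<subseteq> span B" "finite B"
  shows "CARD('n) \<le> card B"
proof -
  have "p \<in> (\<Union>c\<in>\<A>. fst c)"
    using atlas by (simp add: smooth_atlas_def)
  then obtain c where c: "c \<in> \<A>" "p \<in> fst c"
    by blast
  define L :: "'a functional \<Rightarrow> real ^ 'n" where "L v = (\<chi> i. v (\<lambda>q. snd c q $ i))" for v
  have L: "linear L"
    by (rule linearI) (simp_all add: L_def vec_eq_iff scaleR_fun_def)
  have "w \<in> L ` tangent_space \<A> p" for w
  proof
    let ?v = "\<lambda>f. if smooth_near \<A> p f
      then frechet_derivative (f \<circ> chart_inv c) (at (snd c p)) w else 0"
    show "?v \<in> tangent_space \<A> p"
      using c by (rule chart_derivative_tangent)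
    have "?v (\<lambda>q. snd c q $ i) = w $ i" for i
    proof -
      have c_open: "open (fst c)" "open (snd c ` fst c)"
        using chart[OF c(1)] by (auto simp: is_chart_def)
      have "((\<lambda>q. snd c q $ i) \<circ> chart_inv c has_derivative (\<lambda>w. w $ i)) (at (snd c p))"
        using bounded_linear_imp_has_derivative[OF bounded_linear_vec_nth] c_open(2)
        by (rule has_derivative_transform_within_open)
          (use c chart_inv_left[OF chart[OF c(1)]] in auto)
      then have "frechet_derivative ((\<lambda>q. snd c q $ i) \<circ> chart_inv c) (at (snd c p)) = (\<lambda>w. w $ i)"
        using frechet_derivative_at by metis
      then show ?thesis
        using smooth_nearI[OF smooth_fun_coordinate[OF c(1)] c_open(1) c(2)] by simp
    qed
    then show "w = L ?v"
      by (simp add: L_def vec_eq_iff)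
  qed
  then have "(UNIV :: (real ^ 'n) set) \<subseteq> span (L ` B)"
    using assms(1) linear_span_image[OF L, of B] by blast
  then have "dim (UNIV :: (real ^ 'n) set) \<le> card (L ` B)"
    using assms(2) by (intro dim_le_card) auto
  then show ?thesis
    using card_image_le[OF assms(2), of L] by simp
qed

section \<open>Linear combinations of fields and brackets of rotated frames\<close>

lemma tangent_space_lincomb:
  assumes "v \<in> tangent_space \<A> p" "w \<in> tangent_space \<A> p"
  shows "a *\<^sub>R v + b *\<^sub>R w \<in> tangent_space \<A> p" (is "?u \<in> _")
proof -
  have D: "\<And>f. \<not> smooth_near \<A> p f \<Longrightarrow> v f = 0"
    "\<And>f g. smooth_near \<A> p f \<Longrightarrow> smooth_near \<A> p g \<Longrightarrow> \<forall>\<^sub>F x in nhds p. f x = g x \<Longrightarrow> v f = v g"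
    "\<And>f g a b. smooth_near \<A> p f \<Longrightarrow> smooth_near \<A> p g \<Longrightarrow>
      v (\<lambda>x. a * f x + b * g x) = a * v f + b * v g"
    "\<And>f g. smooth_near \<A> p f \<Longrightarrow> smooth_near \<A> p g \<Longrightarrow>
      v (\<lambda>x. f x * g x) = f p * v g + g p * v f"
    if "v \<in> tangent_space \<A> p" for v
    using that unfolding tangent_space_def by blast+
  note Dv = D[OF assms(1)] and Dw = D[OF assms(2)]
  show ?thesis
    unfolding tangent_space_def
  proof (intro CollectI conjI allI impI; (elim conjE)?)
    show "?u f = 0" if "\<not> smooth_near \<A> p f" for f
      using Dv(1)[OF that] Dw(1)[OF that] by (simp add: scaleR_fun_def)
  next
    fix f g assume fg: "smooth_near \<A> p f" "smooth_near \<A> p g"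
    show "?u f = ?u g" if "\<forall>\<^sub>F x in nhds p. f x = g x"
      using Dv(2)[OF fg that] Dw(2)[OF fg that] by (simp add: scaleR_fun_def)
    show "?u (\<lambda>x. r * f x + s * g x) = r * ?u f + s * ?u g" for r s
      using Dv(3)[OF fg] Dw(3)[OF fg] by (simp add: scaleR_fun_def algebra_simps)
    show "?u (\<lambda>x. f x * g x) = f p * ?u g + g p * ?u f"
      using Dv(4)[OF fg] Dw(4)[OF fg] by (simp add: scaleR_fun_def algebra_simps)
  qed
qed

lemma vector_field_lincomb:
  assumes "open W" and X: "smooth_vector_field \<A> W X" and Y: "smooth_vector_field \<A> W Y"
    and a: "smooth_fun \<A> W a" and b: "smooth_fun \<A> W b"
    and S: "\<And>x. x \<in> W \<Longrightarrow> S x = a x *\<^sub>R X x + b x *\<^sub>R Y x"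
  shows "smooth_vector_field \<A> W S"
proof -
  have "S x \<in> tangent_space \<A> x" if "x \<in> W" for x
    unfolding S[OF that]
    by (intro tangent_space_lincomb vector_field_tangent[OF X that] vector_field_tangent[OF Y that])
  moreover have "smooth_fun \<A> V (\<lambda>x. S x f)"
    if V: "open V" "V \<subseteq> W" "smooth_fun \<A> V f" for V f
  proof (rule smooth_fun_cong[OF V(1)])
    show "smooth_fun \<A> V (\<lambda>x. a x * X x f + b x * Y x f)"
      by (intro smooth_fun_intros V(1) vector_field_smooth[OF X V] vector_field_smooth[OF Y V]
          smooth_fun_subset[OF a V(2)] smooth_fun_subset[OF b V(2)])
    show "a x * X x f + b x * Y x f = S x f" if "x \<in> V" for x
      using S[of x] that V(2) by (auto simp: scaleR_fun_def)
  qed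
  ultimately show ?thesis by (simp add: smooth_vector_field_def)
qed

text \<open>The rule for linear combinations is applied to \<open>S1\<close>, then to
  \<open>S2\<close> after exchanging the slots. The mixed products of sine and cosine cancel, and
  the squares add up to 1.\<close>

lemma lie_bracket_rotated_frame:
  assumes W: "open W" "p \<in> W"
    and X1: "smooth_vector_field \<A> W X1" and X2: "smooth_vector_field \<A> W X2"
    and \<theta>: "smooth_fun \<A> W \<theta>"
    and S1: "\<And>x. x \<in> W \<Longrightarrow> S1 x = cos (\<theta> x) *\<^sub>R X1 x + sin (\<theta> x) *\<^sub>R X2 x"
    and S2: "\<And>x. x \<in> W \<Longrightarrow> S2 x = - sin (\<theta> x) *\<^sub>R X1 x + cos (\<theta> x) *\<^sub>R X2 x"
  shows "lie_bracket \<A> S1 S2 p = lie_bracket \<A> X1 X2 p - X1 p \<theta> *\<^sub>R X1 p - X2 p \<theta> *\<^sub>R X2 p"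
proof
  fix f
  note cs = smooth_fun_cos[OF W(1) \<theta>] smooth_fun_sin[OF W(1) \<theta>]
  note ms = smooth_fun_minus[OF W(1) cs(2)]
  have vS2: "smooth_vector_field \<A> W S2"
    by (rule vector_field_lincomb[OF W(1) X1 X2 ms cs(1) S2])
  note tX1 = vector_field_tangent[OF X1 W(2)] and tX2 = vector_field_tangent[OF X2 W(2)]
    and tS2 = vector_field_tangent[OF vS2 W(2)]
  note trig = tangent_sin[OF _ W \<theta>] tangent_cos[OF _ W \<theta>] tangent_minus[OF _ W cs(2)]
  have S2\<theta>: "S2 p \<theta> = - sin (\<theta> p) * X1 p \<theta> + cos (\<theta> p) * X2 p \<theta>"
    by (simp add: S2[OF W(2)] scaleR_fun_def)
  have B: "lie_bracket \<A> S1 S2 p f = cos (\<theta> p) * lie_bracket \<A> X1 S2 p f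
      + sin (\<theta> p) * lie_bracket \<A> X2 S2 p f
      + sin (\<theta> p) * S2 p \<theta> * X1 p f - cos (\<theta> p) * S2 p \<theta> * X2 p f"
    using lie_bracket_lincomb_left[OF W X1 X2 vS2 cs S1]
    by (simp add: scaleR_fun_def trig tS2)
  have "lie_bracket \<A> S2 X1 p f = - cos (\<theta> p) * lie_bracket \<A> X1 X2 p f
      + cos (\<theta> p) * X1 p \<theta> * X1 p f + sin (\<theta> p) * X1 p \<theta> * X2 p f"
    using lie_bracket_lincomb_left[OF W X1 X2 X1 ms cs(1) S2] lie_bracket_flip[of X2 X1 p]
    by (simp add: scaleR_fun_def trig tX1 lie_bracket_self)
  then have B1: "lie_bracket \<A> X1 S2 p f = cos (\<theta> p) * lie_bracket \<A> X1 X2 p f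
      - cos (\<theta> p) * X1 p \<theta> * X1 p f - sin (\<theta> p) * X1 p \<theta> * X2 p f"
    using lie_bracket_flip[of X1 S2 p] by simp
  have "lie_bracket \<A> S2 X2 p f = - sin (\<theta> p) * lie_bracket \<A> X1 X2 p f
      + cos (\<theta> p) * X2 p \<theta> * X1 p f + sin (\<theta> p) * X2 p \<theta> * X2 p f"
    using lie_bracket_lincomb_left[OF W X1 X2 X2 ms cs(1) S2]
    by (simp add: scaleR_fun_def trig tX2 lie_bracket_self)
  then have B2: "lie_bracket \<A> X2 S2 p f = sin (\<theta> p) * lie_bracket \<A> X1 X2 p f
      - cos (\<theta> p) * X2 p \<theta> * X1 p f - sin (\<theta> p) * X2 p \<theta> * X2 p f"
    using lie_bracket_flip[of X2 S2 p] by simp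
  have "lie_bracket \<A> S1 S2 p f = lie_bracket \<A> X1 X2 p f - X1 p \<theta> * X1 p f - X2 p \<theta> * X2 p f"
    using B B1 B2 S2\<theta> sin_cos_squared_add[of "\<theta> p"] by algebra
  then show "lie_bracket \<A> S1 S2 p f =
      (lie_bracket \<A> X1 X2 p - X1 p \<theta> *\<^sub>R X1 p - X2 p \<theta> *\<^sub>R X2 p) f"
    by (simp add: scaleR_fun_def)
qed

text \<open>The calculation concerns two fields on any smooth manifold; the bracket generating
  condition enters through \<open>indep\<close>.\<close>

lemma carnot_rotation:
  fixes X1 X2 S1 S2 :: "'a field"
  defines "X3 \<equiv> lie_bracket \<A> X1 X2" and "S3 \<equiv> lie_bracket \<A> S1 S2"
  assumes W: "open W" "p \<in> W"
    and X1: "smooth_vector_field \<A> W X1" and X2: "smooth_vector_field \<A> W X2"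
    and \<theta>: "smooth_fun \<A> W \<theta>"
    and S1: "\<And>x. x \<in> W \<Longrightarrow> S1 x = cos (\<theta> x) *\<^sub>R X1 x + sin (\<theta> x) *\<^sub>R X2 x"
    and S2: "\<And>x. x \<in> W \<Longrightarrow> S2 x = - sin (\<theta> x) *\<^sub>R X1 x + cos (\<theta> x) *\<^sub>R X2 x"
    and indep: "\<And>a b c. a *\<^sub>R X1 p + b *\<^sub>R X2 p + c *\<^sub>R X3 p = 0 \<Longrightarrow> a = 0 \<and> b = 0 \<and> c = 0"
    and X13: "lie_bracket \<A> X1 X3 p = 0" and X23: "lie_bracket \<A> X2 X3 p = 0"
    and S13: "lie_bracket \<A> S1 S3 p = 0" and S23: "lie_bracket \<A> S2 S3 p = 0"
  shows "(\<forall>X\<in>{X1, X2}. X p \<theta> = 0) \<and>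
    (\<forall>X\<in>{X1, X2}. \<forall>Y\<in>{X1, X2}. X p (\<lambda>x. Y x \<theta>) = 0) \<and> X3 p = S3 p"
proof -
  let ?c = "cos (\<theta> p)" and ?s = "sin (\<theta> p)"
  \<comment> \<open>These are kept as functions rather than values at \<open>p\<close>, since
    differentiating them again produces the second order derivatives of \<theta>.\<close>
  define T1 T2 where T: "T1 x = X1 x \<theta>" "T2 x = X2 x \<theta>" for x
  define K where "K x = T1 x *\<^sub>R X1 x + T2 x *\<^sub>R X2 x" for x
  have sT: "smooth_fun \<A> W T1" "smooth_fun \<A> W T2"
    unfolding T[abs_def] by (rule vector_field_smooth[OF _ W(1) order_refl \<theta>], fact)+
  note cs = smooth_fun_cos[OF W(1) \<theta>] smooth_fun_sin[OF W(1) \<theta>]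
  note ms = smooth_fun_minus[OF W(1) cs(2)]
  note one = smooth_fun_const[OF W(1), of 1] smooth_fun_const[OF W(1), of "-1"]
  have vX3: "smooth_vector_field \<A> W X3"
    unfolding X3_def by (rule lie_bracket_vector_field[OF W(1) X1 X2])
  have vK: "smooth_vector_field \<A> W K"
    by (rule vector_field_lincomb[OF W(1) X1 X2 sT K_def])
  \<comment> \<open>The identity holds on all of \<open>W\<close>, as \<open>S3\<close> is bracketed
    once more. The constant coefficients 1 and -1 put it in the form expected by the lemmas on
    linear combinations.\<close>
  have S3: "S3 x = 1 *\<^sub>R X3 x + (-1) *\<^sub>R K x" if "x \<in> W" for x
    using lie_bracket_rotated_frame[OF W(1) that X1 X2 \<theta> S1 S2]
    by (simp add: S3_def X3_def K_def T)
  have vS3: "smooth_vector_field \<A> W S3"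
    by (rule vector_field_lincomb[OF W(1) vX3 vK one S3])
  note tX1 = vector_field_tangent[OF X1 W(2)] and tX2 = vector_field_tangent[OF X2 W(2)]
    and tS3 = vector_field_tangent[OF vS3 W(2)]
  note trig = tangent_sin[OF _ W \<theta>] tangent_cos[OF _ W \<theta>] tangent_minus[OF _ W cs(2)]
  define \<tau> where "\<tau> = S3 p \<theta>"
  have K1: "lie_bracket \<A> K X1 p = - T2 p *\<^sub>R X3 p - X1 p T1 *\<^sub>R X1 p - X1 p T2 *\<^sub>R X2 p"
    using lie_bracket_lincomb_left[OF W X1 X2 X1 sT K_def] lie_bracket_flip[of X2 X1 p]
    by (simp add: lie_bracket_self X3_def)
  have K2: "lie_bracket \<A> K X2 p = T1 p *\<^sub>R X3 p - X2 p T1 *\<^sub>R X1 p - X2 p T2 *\<^sub>R X2 p"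
    using lie_bracket_lincomb_left[OF W X1 X2 X2 sT K_def]
    by (simp add: lie_bracket_self X3_def)
  \<comment> \<open>Since \<open>[X1, X3]\<close> vanishes at \<open>p\<close>, only
    \<open>- [X1, K] = [K, X1]\<close> remains.\<close>
  have B1: "lie_bracket \<A> X1 S3 p = - T2 p *\<^sub>R X3 p - X1 p T1 *\<^sub>R X1 p - X1 p T2 *\<^sub>R X2 p"
    using lie_bracket_lincomb_left[OF W vX3 vK X1 one S3] lie_bracket_flip[of X3 X1 p]
      lie_bracket_flip[of X1 S3 p] K1 X13
    by (simp add: tangent_const[OF tX1])
  have B2: "lie_bracket \<A> X2 S3 p = T1 p *\<^sub>R X3 p - X2 p T1 *\<^sub>R X1 p - X2 p T2 *\<^sub>R X2 p"
    using lie_bracket_lincomb_left[OF W vX3 vK X2 one S3] lie_bracket_flip[of X3 X2 p]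
      lie_bracket_flip[of X2 S3 p] K2 X23
    by (simp add: tangent_const[OF tX2])
  \<comment> \<open>The terms with \<tau> come from \<open>S3\<close> differentiating the cosine and
    sine coefficients of \<open>S1\<close>.\<close>
  have "(- ?c * X1 p T1 - ?s * X2 p T1 + ?s * \<tau>) *\<^sub>R X1 p
      + (- ?c * X1 p T2 - ?s * X2 p T2 - ?c * \<tau>) *\<^sub>R X2 p
      + (- ?c * T2 p + ?s * T1 p) *\<^sub>R X3 p = lie_bracket \<A> S1 S3 p"
    using lie_bracket_lincomb_left[OF W X1 X2 vS3 cs S1]
    by (simp add: B1 B2 trig tS3 \<tau>_def algebra_simps)
  from indep[OF this[unfolded S13]]
  have E1: "- ?c * X1 p T1 - ?s * X2 p T1 + ?s * \<tau> = 0"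
    "- ?c * X1 p T2 - ?s * X2 p T2 - ?c * \<tau> = 0" "- ?c * T2 p + ?s * T1 p = 0"
    by auto
  have "(?s * X1 p T1 - ?c * X2 p T1 + ?c * \<tau>) *\<^sub>R X1 p
      + (?s * X1 p T2 - ?c * X2 p T2 + ?s * \<tau>) *\<^sub>R X2 p
      + (?s * T2 p + ?c * T1 p) *\<^sub>R X3 p = lie_bracket \<A> S2 S3 p"
    using lie_bracket_lincomb_left[OF W X1 X2 vS3 ms cs(1) S2]
    by (simp add: B1 B2 trig tS3 \<tau>_def algebra_simps)
  from indep[OF this[unfolded S23]]
  have E2: "?s * X1 p T1 - ?c * X2 p T1 + ?c * \<tau> = 0"
    "?s * X1 p T2 - ?c * X2 p T2 + ?s * \<tau> = 0" "?s * T2 p + ?c * T1 p = 0"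
    by auto
  note sq = sin_cos_squared_add[of "\<theta> p"]
  \<comment> \<open>The equations from \<open>S1\<close> and \<open>S2\<close> differ from those for
    \<open>X1\<close> and \<open>X2\<close> by a rotation, whose determinant is 1; \<open>sq\<close>
    lets it be inverted, here and for the second derivatives.\<close>
  have t: "T1 p = 0" "T2 p = 0"
    using E1(3) E2(3) sq by algebra+
  have second: "X1 p T1 = 0" "X2 p T1 = \<tau>" "X1 p T2 = - \<tau>" "X2 p T2 = 0"
    using E1(1,2) E2(1,2) sq by algebra+
  have S3p: "S3 p = X3 p"
    using S3[OF W(2)] t by (simp add: K_def)
  \<comment> \<open>The bracket evaluated on \<theta> itself is the difference of the mixed second
    derivatives, that is, \<open>- 2 * \<tau>\<close>.\<close>
  have "X3 p \<theta> = X1 p T2 - X2 p T1"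
    unfolding X3_def T[abs_def] by (rule lie_bracket_eq[OF \<theta> W])
  moreover have "X3 p \<theta> = \<tau>"
    unfolding \<tau>_def S3p ..
  ultimately have "\<tau> = 0"
    using second by linarith
  with t second S3p show ?thesis
    by (simp add: T[abs_def])
qed

end

section \<open>Orthonormal frames and the bracket generating condition\<close>

lemma smooth_fiber_innerD:
  assumes "smooth_fiber_inner \<A> H g"
  shows smooth_fiber_inner_commute: "u \<in> H x \<Longrightarrow> v \<in> H x \<Longrightarrow> g x u v = g x v u"
    and smooth_fiber_inner_add:
      "u \<in> H x \<Longrightarrow> v \<in> H x \<Longrightarrow> w \<in> H x \<Longrightarrow> g x (u + v) w = g x u w + g x v w"
    and smooth_fiber_inner_scaleR: "u \<in> H x \<Longrightarrow> v \<in> H x \<Longrightarrow> g x (r *\<^sub>R u) v = r * g x u v"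
    and smooth_fiber_inner_smooth: "open W \<Longrightarrow> smooth_section \<A> H W X \<Longrightarrow> smooth_section \<A> H W Y \<Longrightarrow>
      smooth_fun \<A> W (\<lambda>x. g x (X x) (Y x))"
  using assms[unfolded smooth_fiber_inner_def, THEN conjunct1]
    assms[unfolded smooth_fiber_inner_def, THEN conjunct2, THEN conjunct1]
    assms[unfolded smooth_fiber_inner_def, THEN conjunct2, THEN conjunct2, THEN conjunct1]
    assms[unfolded smooth_fiber_inner_def, THEN conjunct2, THEN conjunct2, THEN conjunct2, THEN conjunct2]
  by blast+

text \<open>Bilinearity is available only inside \<open>H x\<close>, so membership is settled first.
  With \<open>v = 0\<close> the lemma also gives the linear independence of the frame.\<close>

lemma orthonormal_frame_inner:
  assumes fi: "smooth_fiber_inner \<A> H g" and fr: "orthonormal_frame \<A> H g U X1 X2"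
    and x: "x \<in> U" and v: "v = a *\<^sub>R X1 x + b *\<^sub>R X2 x"
  shows "g x v (X1 x) = a" "g x v (X2 x) = b"
proof -
  have H: "H x = span {X1 x, X2 x}" and
    on: "g x (X1 x) (X1 x) = 1" "g x (X2 x) (X2 x) = 1" "g x (X1 x) (X2 x) = 0"
    using fr x unfolding orthonormal_frame_def by auto
  have X: "X1 x \<in> H x" "X2 x \<in> H x"
    unfolding H by (auto intro: span_base)
  then have aX: "a *\<^sub>R X1 x \<in> H x" "b *\<^sub>R X2 x \<in> H x"
    unfolding H by (auto intro: span_scale)
  show "g x v (X1 x) = a" "g x v (X2 x) = b"
    unfolding v smooth_fiber_inner_add[OF fi aX X(1)] smooth_fiber_inner_add[OF fi aX X(2)]
      smooth_fiber_inner_scaleR[OF fi X(1,1)] smooth_fiber_inner_scaleR[OF fi X(1,2)]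
      smooth_fiber_inner_scaleR[OF fi X(2,1)] smooth_fiber_inner_scaleR[OF fi X(2,2)]
      smooth_fiber_inner_commute[OF fi X(2,1)] on
    by simp_all
qed

text \<open>Writing the coefficients as inner products makes them smooth functions of the point when
  \<open>v\<close> runs through a smooth section.\<close>

lemma orthonormal_frame_expansion:
  assumes "smooth_fiber_inner \<A> H g" "orthonormal_frame \<A> H g U X1 X2"
    and "x \<in> U" and v: "v \<in> H x"
  shows "v = g x v (X1 x) *\<^sub>R X1 x + g x v (X2 x) *\<^sub>R X2 x"
proof -
  have "H x = span {X1 x, X2 x}"
    using assms unfolding orthonormal_frame_def by blast
  with v obtain a b where "v - a *\<^sub>R X1 x = b *\<^sub>R X2 x"
    by (auto simp: span_breakdown_eq[of v] span_singleton)
  then have "v = a *\<^sub>R X1 x + b *\<^sub>R X2 x"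
    by (simp add: algebra_simps)
  then show ?thesis
    unfolding orthonormal_frame_inner[OF assms(1-3) \<open>v = _\<close>] .
qed

lemma orthonormal_frame_bracket_independent:
  assumes sR: "sub_riemannian_2_3 \<A> H g" and U: "open U" "p \<in> U"
    and fr: "orthonormal_frame \<A> H g U X1 X2"
    and eq: "a *\<^sub>R X1 p + b *\<^sub>R X2 p + c *\<^sub>R lie_bracket \<A> X1 X2 p = 0"
  shows "a = 0 \<and> b = 0 \<and> c = 0"
proof -
  have atlas: "smooth_atlas \<A>" and fi: "smooth_fiber_inner \<A> H g"
    and gen: "span (H p \<union> {lie_bracket \<A> X Y p | X Y W. open W \<and> p \<in> W \<and>
        smooth_section \<A> H W X \<and> smooth_section \<A> H W Y}) = tangent_space \<A> p"
    using sR unfolding sub_riemannian_2_3_def by blast+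
  interpret smooth_manifold \<A> by unfold_locales (rule atlas)
  define X3 where "X3 = lie_bracket \<A> X1 X2"
  have sec: "smooth_section \<A> H U X1" "smooth_section \<A> H U X2"
    and H: "H p = span {X1 p, X2 p}"
    using fr U unfolding orthonormal_frame_def by auto
  note smooth_inner = smooth_fiber_inner_smooth[OF fi]
  have section_subset: "smooth_section \<A> H V X" if "smooth_section \<A> H W X" "V \<subseteq> W" for V W X
    using that vector_field_subset unfolding smooth_section_def by blast
  \<comment> \<open>Expanding both sections in the frame leaves brackets of frame fields plus
    multiples of \<open>X1 p\<close> and \<open>X2 p\<close> from the differentiated
    coefficients.\<close>
  have bracket: "lie_bracket \<A> Y Z p \<in> span {X1 p, X2 p, X3 p}"
    if W: "open W" "p \<in> W" and YZ: "smooth_section \<A> H W Y" "smooth_section \<A> H W Z" for W Y Z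
  proof -
    define V where "V = U \<inter> W"
    have V: "open V" "p \<in> V" "V \<subseteq> U" "V \<subseteq> W"
      using U W by (auto simp: V_def)
    have sX: "smooth_section \<A> H V X1" "smooth_section \<A> H V X2"
      using section_subset sec V(3) by auto
    then have vX: "smooth_vector_field \<A> V X1" "smooth_vector_field \<A> V X2"
      by (auto simp: smooth_section_def)
    let ?S = "span {X1 p, X2 p, X3 p}"
    have base: "X1 p \<in> ?S" "X2 p \<in> ?S" "X3 p \<in> ?S" "lie_bracket \<A> X2 X1 p \<in> ?S"
      using lie_bracket_flip[of X2 X1 p] by (auto simp: X3_def intro: span_base span_neg)
    \<comment> \<open>One slot is expanded at a time, with any field \<open>Z\<close> in the other:
      first a frame field, then a general section.\<close>
    have expand: "lie_bracket \<A> Y Z p \<in> ?S"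
      if Y: "smooth_section \<A> H W Y" and Z: "smooth_vector_field \<A> V Z"
        and "lie_bracket \<A> X1 Z p \<in> ?S" "lie_bracket \<A> X2 Z p \<in> ?S" for Y Z
    proof -
      have sY: "smooth_section \<A> H V Y"
        using section_subset Y V(4) by blast
      then have "Y x = g x (Y x) (X1 x) *\<^sub>R X1 x + g x (Y x) (X2 x) *\<^sub>R X2 x" if "x \<in> V" for x
        using that V(3) by (intro orthonormal_frame_expansion[OF fi fr]) (auto simp: smooth_section_def)
      then have "lie_bracket \<A> Y Z p = g p (Y p) (X1 p) *\<^sub>R lie_bracket \<A> X1 Z p
          + g p (Y p) (X2 p) *\<^sub>R lie_bracket \<A> X2 Z p
          - Z p (\<lambda>x. g x (Y x) (X1 x)) *\<^sub>R X1 p - Z p (\<lambda>x. g x (Y x) (X2 x)) *\<^sub>R X2 p"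
        by (rule lie_bracket_lincomb_left[OF V(1,2) vX Z smooth_inner[OF V(1) sY sX(1)]
              smooth_inner[OF V(1) sY sX(2)]])
      with that(3,4) base show ?thesis
        by (simp add: span_add span_diff span_scale)
    qed
    \<comment> \<open>Expanding \<open>Z\<close> against a frame field and flipping the result
      provides the hypotheses of \<open>expand\<close> for \<open>Y\<close> against
      \<open>Z\<close>.\<close>
    have "lie_bracket \<A> Z X p \<in> ?S" if "X = X1 \<or> X = X2" for X
      using that expand[OF YZ(2)] vX base by (auto simp: lie_bracket_self span_zero X3_def)
    then have "lie_bracket \<A> X Z p \<in> ?S" if "X = X1 \<or> X = X2" for X
      using that lie_bracket_flip[of X Z p] span_neg by metis
    moreover have "smooth_vector_field \<A> V Z"
      using section_subset[OF YZ(2) V(4)] by (simp add: smooth_section_def)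
    ultimately show ?thesis
      using expand[OF YZ(1)] by blast
  qed
  have "c = 0"
  proof (rule ccontr)
    assume c: "c \<noteq> 0"
    have "c *\<^sub>R X3 p = - a *\<^sub>R X1 p - b *\<^sub>R X2 p"
      using eq by (simp add: X3_def algebra_simps eq_neg_iff_add_eq_0)
    also have "\<dots> \<in> span {X1 p, X2 p}"
      by (intro span_diff span_scale span_base) auto
    finally have "inverse c *\<^sub>R c *\<^sub>R X3 p \<in> span {X1 p, X2 p}"
      by (rule span_scale)
    with c have X3: "X3 p \<in> span {X1 p, X2 p}"
      by simp
    have "span {X1 p, X2 p, X3 p} \<subseteq> span {X1 p, X2 p}"
    proof (rule span_minimal)
      show "{X1 p, X2 p, X3 p} \<subseteq> span {X1 p, X2 p}"
        using X3 span_superset[of "{X1 p, X2 p}"] by blast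
    qed (rule subspace_span)
    then have bracket': "lie_bracket \<A> Y Z p \<in> span {X1 p, X2 p}"
      if "open W" "p \<in> W" "smooth_section \<A> H W Y" "smooth_section \<A> H W Z" for W Y Z
      by (rule subsetD) (rule bracket[OF that])
    have "H p \<union> {lie_bracket \<A> X Y p | X Y W. open W \<and> p \<in> W \<and>
        smooth_section \<A> H W X \<and> smooth_section \<A> H W Y} \<subseteq> span {X1 p, X2 p}"
    proof (rule Un_least)
      show "H p \<subseteq> span {X1 p, X2 p}"
        unfolding H ..
      show "{lie_bracket \<A> X Y p | X Y W. open W \<and> p \<in> W \<and>
          smooth_section \<A> H W X \<and> smooth_section \<A> H W Y} \<subseteq> span {X1 p, X2 p}"
        by clarify (rule bracket')
    qed
    then have "tangent_space \<A> p \<subseteq> span {X1 p, X2 p}"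
      unfolding gen[symmetric] by (rule span_minimal) (rule subspace_span)
    \<comment> \<open>Two vectors would span the tangent space of a 3-manifold.\<close>
    then have "CARD(3) \<le> card {X1 p, X2 p}"
      by (rule tangent_space_card_le) simp
    also have "\<dots> \<le> 2"
      by (simp add: card_insert_if)
    finally show False by simp
  qed
  \<comment> \<open>Zero now has two expansions in the frame. Taking inner products with the frame
    fields identifies their coefficients.\<close>
  have "0 = a *\<^sub>R X1 p + b *\<^sub>R X2 p" "0 = 0 *\<^sub>R X1 p + 0 *\<^sub>R X2 p"
    using eq \<open>c = 0\<close> by simp_all
  from this[THEN orthonormal_frame_inner(1)[OF fi fr U(2)]]
    this[THEN orthonormal_frame_inner(2)[OF fi fr U(2)]]
  show ?thesis
    using \<open>c = 0\<close> by simp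
qed

theorem corollary10:
  fixes \<A> :: "('a::{t2_space, second_countable_topology}, 3) chart set"
    and H :: "'a \<Rightarrow> 'a functional set"
    and g :: "'a \<Rightarrow> 'a functional \<Rightarrow> 'a functional \<Rightarrow> real"
    and U :: "'a set" and p :: 'a
    and X1 X2 X3 X1' X2' X3' :: "'a field"
    and \<theta> :: "'a \<Rightarrow> real"
  assumes "sub_riemannian_2_3 \<A> H g" and "orientable \<A>"
    and "open U" and "p \<in> U"
    and "orthonormal_frame \<A> H g U X1 X2"
    and "orthonormal_frame \<A> H g U X1' X2'"
    and "smooth_fun \<A> U \<theta>"
    and "\<forall>x\<in>U. X1' x = cos (\<theta> x) *\<^sub>R X1 x + sin (\<theta> x) *\<^sub>R X2 x"
    and "\<forall>x\<in>U. X2' x = - sin (\<theta> x) *\<^sub>R X1 x + cos (\<theta> x) *\<^sub>R X2 x"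
    and "X3 = lie_bracket \<A> X1 X2"
    and "X3' = lie_bracket \<A> X1' X2'"
    and "carnot_frame \<A> H g U p X1 X2"
    and "carnot_frame \<A> H g U p X1' X2'"
  shows "(\<forall>X\<in>{X1, X2}. X p \<theta> = 0) \<and>
         (\<forall>X\<in>{X1, X2}. \<forall>Y\<in>{X1, X2}. X p (\<lambda>x. Y x \<theta>) = 0) \<and>
         X3 p = X3' p"
proof -
  interpret smooth_manifold \<A>
    using assms(1) by unfold_locales (simp add: sub_riemannian_2_3_def)
  have fields: "smooth_vector_field \<A> U X1" "smooth_vector_field \<A> U X2"
    using assms(5) by (simp_all add: orthonormal_frame_def smooth_section_def)
  show ?thesis
    unfolding assms(10,11)
  \<comment> \<open>The open set is \<open>U\<close> itself. Besides independence, the remaining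
    goals are the rotation formulas and the four vanishing brackets of the two Carnot
    frames.\<close>
  proof (rule carnot_rotation[OF assms(3,4) fields assms(7)])
    show "a = 0 \<and> b = 0 \<and> c = 0"
      if "a *\<^sub>R X1 p + b *\<^sub>R X2 p + c *\<^sub>R lie_bracket \<A> X1 X2 p = 0" for a b c
      using assms(1,3,4,5) that by (rule orthonormal_frame_bracket_independent)
  qed (use assms(8,9,12,13) in \<open>auto simp: carnot_frame_def\<close>)
qed

end
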